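(* Let $\mathcal{U}^{F,n}_{D,Q,\mathcal{P}}$ be a Chudnovsky$^2$ multiplication algorithm such that $D$ is an effective divisor, $D-Q$ is a non-special divisor of degree $g-1$, and $|\mathcal{P}|=\dim\mathcal{L}(2D)=N$. For $\pi$ in the symmetric group $S_N$ on $\{1,\dots,N\}$, let $\pi(\mathcal{P})=\{P_{\pi(1)},\dots,P_{\pi(N)}\}$ be the reordered set of places, the bases of $\mathcal{L}(D)$, $\mathcal{L}(2D)$ and $F_Q$ being kept the same. Then for every $\pi\in S_N$, $$\mu_s(\mathcal{U}^{F,n}_{D,Q,\mathcal{P}})=\mu_s(\mathcal{U}^{F,n}_{D,Q,\pi(\mathcal{P})})\qquad\text{and}\qquad \mu_{s,0}(\mathcal{U}^{F,n}_{D,Q,\mathcal{P}})=\mu_{s,0}(\mathcal{U}^{F,n}_{D,Q,\pi(\mathcal{P})}).$$ In particular, each of the numbers $N_z(T_D)$, $N_1(T_D)$, $N_z(C\,T_{2D}^{-1})$ and $N_1(C\,T_{2D}^{-1})$ is unchanged when $\mathcal{P}$ is replaced by $\pi(\mathcal{P})$.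
   Context: Setting. $q$ is a prime power, $n\ge 1$ an integer, $F/\mathbb{F}_q$ an algebraic function field of genus $g$, $Q$ a place of $F/\mathbb{F}_q$ of degree $n$ with valuation ring $\mathcal{O}_Q$ and residue class field $F_Q=\mathcal{O}_Q/Q\cong\mathbb{F}_{q^n}$, $D$ a divisor of $F/\mathbb{F}_q$, and $\mathcal{P}=\{P_1,\dots,P_N\}$ an ordered set of distinct places of degree one. $\mathcal{L}(D)$ denotes the Riemann–Roch space of $D$. It is assumed that the support of $D$ contains none of $Q,P_1,\dots,P_N$, that $Ev_Q:\mathcal{L}(D)\to F_Q$, $f\mapsto f(Q)$, is surjective, and that $Ev_{\mathcal{P}}:\mathcal{L}(2D)\to\mathbb{F}_q^N$, $f\mapsto(f(P_1),\dots,f(P_N))$, is injective. Under the hypotheses of the statement, $Ev_Q$ and $Ev_{\mathcal{P}}$ are isomorphisms, $\mathcal{L}(D)\subseteq\mathcal{L}(2D)\subseteq\mathcal{O}_Q$, $\dim\mathcal{L}(D)=n$ and $N=2n+g-1$. Let $E_Q:\mathcal{O}_Q\to F_Q$ be the canonical projection. The Chudnovsky$^2$ multiplication algorithm $\mathcal{U}^{F,n}_{D,Q,\mathcal{P}}$ computes $xy=\mathcal{U}^R(\mathcal{U}^A(x)\odot\mathcal{U}^A(y))$ for $x,y\in F_Q$, with $\odot$ the coordinatewise product, $\mathcal{U}^{A}:=Ev_{\mathcal{P}}|_{\mathcal{L}(D)}\circ Ev_Q^{-1}$ and $\mathcal{U}^{R}:=E_Q|_{\mathcal{L}(2D)}\circ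 Ev_{\mathcal{P}}^{-1}$. Bases and matrices. $\mathcal{B}_{2D}=\mathcal{B}_D\cup\mathcal{B}_D^c$ is an ordered basis of $\mathcal{L}(2D)$ whose first $n$ elements $\mathcal{B}_D$ form a basis of $\mathcal{L}(D)$; $\mathcal{B}_Q=Ev_Q(\mathcal{B}_D)$ is the basis of $F_Q$; $\mathbb{F}_q^N$ has its canonical basis. $T_{2D}$ is the matrix of $Ev_{\mathcal{P}}$ in the basis $\mathcal{B}_{2D}$; $T_D$ is the matrix of the first $n$ columns of $T_{2D}$; $C$ is the matrix of $E_Q|_{\mathcal{L}(2D)}$ in the bases $\mathcal{B}_{2D}$, $\mathcal{B}_Q$. For a matrix $M$ over $\mathbb{F}_q$, $N_z(M)$ (resp. $N_1(M)$) is the number of entries equal to $0$ (resp. $1$). Scalar complexities: with $N_z=2N_z(T_D)+N_z(C\,T_{2D}^{-1})$ and $N_1=2N_1(T_D)+N_1(C\,T_{2D}^{-1})$, one sets $\mu_s(\mathcal{U}^{F,n}_{D,Q,\mathcal{P}})=3n(2n+g-1)-N_z-N_1$ and $\mu_{s,0}(\mathcal{U}^{F,n}_{D,Q,\mathcal{P}})=3n(2n+g-1)-N_z$. *)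

theory Defs
  imports
    "HOL-Algebra.Algebra"
    "HOL-Algebra.Algebraic_Closure_Type"
    "HOL-Algebra.Finite_Extensions"
    "HOL-Algebra.Free_Abelian_Groups"
    "HOL-Combinatorics.Permutations"
    "Jordan_Normal_Form.Gauss_Jordan_Elimination"
begin

text \<open>
  The function field is a whole type \<open>'f\<close> of class \<open>field\<close>, and the constant field is a
  subset \<open>K\<close> of it. The ring-theoretic notions of HOL-Algebra are applied to \<open>'f\<close> through
  the record \<open>\<F>\<close>. Since \<open>K\<close> consists of elements of \<open>'f\<close>, matrices over \<open>K\<close> are matrices
  of type \<open>'f mat\<close> with entries in \<open>K\<close>; inverses and products of such matrices do not
  depend on whether they are formed over \<open>K\<close> or over \<open>'f\<close>.
\<close>

abbreviation ambient_ring :: "'f::field ring"  (\<open>\<F>\<close>)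
  where "\<F> \<equiv> ring_of_type_algebra"

definition algebraic_function_field :: "'f::field set \<Rightarrow> bool" where
  "algebraic_function_field K \<longleftrightarrow>
     subfield K \<F> \<and>
     (\<exists>x. (ring.transcendental \<F> over K) x \<and>
          ring.finite_dimension \<F> (generate_field \<F> (insert x K)) (carrier \<F>))"


subsection \<open>Places\<close>

definition valuation_ring :: "'f::field set \<Rightarrow> 'f set \<Rightarrow> bool" where
  "valuation_ring K V \<longleftrightarrow>
     subring V \<F> \<and> K \<subset> V \<and> V \<subset> UNIV \<and> (\<forall>z. z \<noteq> 0 \<longrightarrow> z \<in> V \<or> inverse z \<in> V)"

definition place :: "'f::field set \<Rightarrow> 'f set \<Rightarrow> bool" where
  "place K P \<longleftrightarrow> (\<exists>V. valuation_ring K V \<and> maximalideal P (\<F>\<lparr>carrier := V\<rparr>))"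

text \<open>The valuation ring of a place is unique: it consists of \<open>0\<close> and of all \<open>z \<noteq> 0\<close>
  with \<open>inverse z \<notin> P\<close>.\<close>

definition ring_of_place :: "'f::field set \<Rightarrow> 'f set \<Rightarrow> 'f ring"  (\<open>\<O>\<close>) where
  "\<O> K P = \<F>\<lparr>carrier := (THE V. valuation_ring K V \<and> maximalideal P (\<F>\<lparr>carrier := V\<rparr>))\<rparr>"

definition residue_field :: "'f::field set \<Rightarrow> 'f set \<Rightarrow> 'f set ring" where
  "residue_field K P = \<O> K P Quot P"

definition residue_map :: "'f::field set \<Rightarrow> 'f set \<Rightarrow> 'f \<Rightarrow> 'f set" where
  "residue_map K P f = P +>\<^bsub>\<O> K P\<^esub> f"

text \<open>The residue field is a vector space over the image of \<open>K\<close>, which is isomorphic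
  to \<open>K\<close> because \<open>K \<inter> P = {0}\<close>.\<close>

definition place_degree :: "'f::field set \<Rightarrow> 'f set \<Rightarrow> nat" where
  "place_degree K P =
     (ring.dim (residue_field K P) over (residue_map K P ` K)) (carrier (residue_field K P))"

text \<open>The discrete valuation at \<open>P\<close>, meaningful for \<open>z \<noteq> 0\<close> only; \<open>t\<close> is a local
  parameter. The usual convention that the value at \<open>0\<close> is infinite has to be
  treated separately wherever it matters.\<close>

definition place_valuation :: "'f::field set \<Rightarrow> 'f set \<Rightarrow> 'f \<Rightarrow> int" where
  "place_valuation K P z =
     (THE m. \<exists>t\<in>carrier (\<O> K P). \<exists>u\<in>Units (\<O> K P). PIdl\<^bsub>\<O> K P\<^esub> t = P \<and> z = t powi m * u)"


subsection \<open>Divisors\<close>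

text \<open>Divisors are the elements of the free abelian group on the places. The coefficient
  of \<open>P\<close> in \<open>A\<close> is \<open>Poly_Mapping.lookup A P\<close>, the support of \<open>A\<close> is \<open>Poly_Mapping.keys A\<close>.\<close>

definition divisors :: "'f::field set \<Rightarrow> ('f set \<Rightarrow>\<^sub>0 int) set" where
  "divisors K = carrier (free_Abelian_group {P. place K P})"

definition effective :: "('f::field set \<Rightarrow>\<^sub>0 int) \<Rightarrow> bool" where
  "effective A \<longleftrightarrow> (\<forall>P. Poly_Mapping.lookup A P \<ge> 0)"

definition divisor_degree :: "'f::field set \<Rightarrow> ('f set \<Rightarrow>\<^sub>0 int) \<Rightarrow> int" where
  "divisor_degree K A =
     (\<Sum>P\<in>Poly_Mapping.keys A. Poly_Mapping.lookup A P * int (place_degree K P))"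

definition riemann_roch_space :: "'f::field set \<Rightarrow> ('f set \<Rightarrow>\<^sub>0 int) \<Rightarrow> 'f set"  (\<open>\<L>\<close>) where
  "\<L> K A =
     {f. f \<noteq> 0 \<longrightarrow> (\<forall>P. place K P \<longrightarrow> place_valuation K P f \<ge> - Poly_Mapping.lookup A P)}"

definition divisor_dim :: "'f::field set \<Rightarrow> ('f set \<Rightarrow>\<^sub>0 int) \<Rightarrow> nat" where
  "divisor_dim K A = (ring.dim \<F> over K) (\<L> K A)"

text \<open>By Riemann's theorem the supremum is a maximum.\<close>

definition genus :: "'f::field set \<Rightarrow> int" where
  "genus K = (SUP A\<in>divisors K. divisor_degree K A - int (divisor_dim K A) + 1)"

definition index_of_speciality :: "'f::field set \<Rightarrow> ('f set \<Rightarrow>\<^sub>0 int) \<Rightarrow> int" where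
  "index_of_speciality K A = int (divisor_dim K A) - divisor_degree K A + genus K - 1"

definition non_special :: "'f::field set \<Rightarrow> ('f set \<Rightarrow>\<^sub>0 int) \<Rightarrow> bool" where
  "non_special K A \<longleftrightarrow> index_of_speciality K A = 0"


subsection \<open>The Chudnovsky-Chudnovsky multiplication algorithm\<close>

text \<open>The value of \<open>f\<close> at a place of degree one: the residue class of \<open>f\<close>, identified
  with an element of \<open>K\<close>.\<close>

definition rational_value :: "'f::field set \<Rightarrow> 'f set \<Rightarrow> 'f \<Rightarrow> 'f" where
  "rational_value K P f = (THE c. c \<in> K \<and> residue_map K P c = residue_map K P f)"

definition Ev :: "'f::field set \<Rightarrow> 'f set list \<Rightarrow> 'f \<Rightarrow> 'f vec" where
  "Ev K Ps f = vec (length Ps) (\<lambda>i. rational_value K (Ps ! i) f)"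

text \<open>Both the evaluation at \<open>Q\<close> on \<open>\<L> K D\<close> and the canonical projection onto the residue
  field of \<open>Q\<close> on \<open>\<L> K (2D)\<close> are restrictions of \<open>residue_map K Q\<close>.\<close>

definition chudnovsky_algorithm ::
  "'f::field set \<Rightarrow> nat \<Rightarrow> ('f set \<Rightarrow>\<^sub>0 int) \<Rightarrow> 'f set \<Rightarrow> 'f set list \<Rightarrow> bool" where
  "chudnovsky_algorithm K n D Q Ps \<longleftrightarrow>
     n \<ge> 1 \<and>
     place K Q \<and> place_degree K Q = n \<and>
     D \<in> divisors K \<and>
     distinct Ps \<and> (\<forall>P\<in>set Ps. place K P \<and> place_degree K P = 1) \<and>
     Poly_Mapping.keys D \<inter> insert Q (set Ps) = {} \<and>
     residue_map K Q ` \<L> K D = carrier (residue_field K Q) \<and>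
     inj_on (Ev K Ps) (\<L> K (frag_cmul 2 D))"

definition ordered_basis :: "'f::field set \<Rightarrow> 'f list \<Rightarrow> 'f set \<Rightarrow> bool" where
  "ordered_basis K B E \<longleftrightarrow> ring.independent \<F> K B \<and> ring.Span \<F> K B = E"

text \<open>An ordered basis of \<open>\<L> K (2D)\<close> whose first \<open>n\<close> elements form a basis of \<open>\<L> K D\<close>.\<close>

definition adapted_basis :: "'f::field set \<Rightarrow> nat \<Rightarrow> ('f set \<Rightarrow>\<^sub>0 int) \<Rightarrow> 'f list \<Rightarrow> bool" where
  "adapted_basis K n D B \<longleftrightarrow>
     ordered_basis K B (\<L> K (frag_cmul 2 D)) \<and>
     n \<le> length B \<and> ordered_basis K (take n B) (\<L> K D)"

definition T2D_mat :: "'f::field set \<Rightarrow> 'f set list \<Rightarrow> 'f list \<Rightarrow> 'f mat" where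
  "T2D_mat K Ps B = mat (length Ps) (length B) (\<lambda>(i, j). Ev K Ps (B ! j) $ i)"

definition TD_mat :: "'f::field set \<Rightarrow> nat \<Rightarrow> 'f set list \<Rightarrow> 'f list \<Rightarrow> 'f mat" where
  "TD_mat K n Ps B = mat (length Ps) n (\<lambda>(i, j). T2D_mat K Ps B $$ (i, j))"

text \<open>The coordinate list in \<open>K\<close> of the residue class \<open>x\<close> at \<open>Q\<close> with respect to the basis
  formed by the residue classes of the first \<open>n\<close> elements of \<open>B\<close>.\<close>

definition residue_coords ::
  "'f::field set \<Rightarrow> nat \<Rightarrow> 'f set \<Rightarrow> 'f list \<Rightarrow> 'f set \<Rightarrow> 'f list" where
  "residue_coords K n Q B x =
     (THE cs. length cs = n \<and> set cs \<subseteq> K \<and>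
        ring.combine (residue_field K Q)
          (map (residue_map K Q) cs) (map (residue_map K Q) (take n B)) = x)"

definition C_mat :: "'f::field set \<Rightarrow> nat \<Rightarrow> 'f set \<Rightarrow> 'f list \<Rightarrow> 'f mat" where
  "C_mat K n Q B =
     mat n (length B) (\<lambda>(i, j). residue_coords K n Q B (residue_map K Q (B ! j)) ! i)"

text \<open>The matrix \<open>C T\<^sub>2\<^sub>D\<^sup>-\<^sup>1\<close>.\<close>

definition CT_mat :: "'f::field set \<Rightarrow> nat \<Rightarrow> 'f set \<Rightarrow> 'f set list \<Rightarrow> 'f list \<Rightarrow> 'f mat" where
  "CT_mat K n Q Ps B = C_mat K n Q B * the (mat_inverse (T2D_mat K Ps B))"

definition count_entries :: "'f::field \<Rightarrow> 'f mat \<Rightarrow> nat" where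
  "count_entries c M = card {(i, j). i < dim_row M \<and> j < dim_col M \<and> M $$ (i, j) = c}"

abbreviation N_z :: "'f::field mat \<Rightarrow> nat" where "N_z \<equiv> count_entries 0"
abbreviation N_1 :: "'f::field mat \<Rightarrow> nat" where "N_1 \<equiv> count_entries 1"

text \<open>The scalar complexities depend on the divisor \<open>D\<close> of the algorithm only through the
  basis \<open>B\<close>.\<close>

definition mu_s0 :: "'f::field set \<Rightarrow> nat \<Rightarrow> 'f set \<Rightarrow> 'f set list \<Rightarrow> 'f list \<Rightarrow> int" where
  "mu_s0 K n Q Ps B =
     3 * int n * (2 * int n + genus K - 1)
     - int (2 * N_z (TD_mat K n Ps B) + N_z (CT_mat K n Q Ps B))"

definition mu_s :: "'f::field set \<Rightarrow> nat \<Rightarrow> 'f set \<Rightarrow> 'f set list \<Rightarrow> 'f list \<Rightarrow> int" where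
  "mu_s K n Q Ps B =
     3 * int n * (2 * int n + genus K - 1)
     - int (2 * N_z (TD_mat K n Ps B) + N_z (CT_mat K n Q Ps B))
     - int (2 * N_1 (TD_mat K n Ps B) + N_1 (CT_mat K n Q Ps B))"

end

theory Submission
  imports Defs "Jordan_Normal_Form.Determinant"
begin

text \<open>
  Reordering the places reorders the coordinates of the evaluation map and leaves everything
  else in place. So \<open>T\<^sub>2\<^sub>D\<close> and \<open>T\<^sub>D\<close> have their rows permuted, and \<open>T\<^sub>2\<^sub>D\<close> becomes \<open>P T\<^sub>2\<^sub>D\<close> for a
  permutation matrix \<open>P\<close>. Its inverse is \<open>T\<^sub>2\<^sub>D\<^sup>-\<^sup>1 P\<^sup>-\<^sup>1\<close>; since \<open>C\<close> is determined by the bases and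
  the place \<open>Q\<close> alone, \<open>C T\<^sub>2\<^sub>D\<^sup>-\<^sup>1\<close> has its columns permuted. Moving the entries of a matrix
  around does not change how often a given scalar occurs among them. The two steps with content
  are \<open>mat_inverse_permute_rows\<close> and \<open>count_entries_permute_entries\<close>.
\<close>

definition permute_entries :: "(nat \<Rightarrow> nat) \<Rightarrow> (nat \<Rightarrow> nat) \<Rightarrow> 'a mat \<Rightarrow> 'a mat" where
  "permute_entries \<sigma> \<tau> M = mat (dim_row M) (dim_col M) (\<lambda>(i, j). M $$ (\<sigma> i, \<tau> j))"

lemma dim_permute_entries [simp]:
  "dim_row (permute_entries \<sigma> \<tau> M) = dim_row M"
  "dim_col (permute_entries \<sigma> \<tau> M) = dim_col M"
  by (simp_all add: permute_entries_def)

lemma permutes_lessThan_less_iff: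
  assumes "\<pi> permutes {..<n::nat}"
  shows "\<pi> i < n \<longleftrightarrow> i < n"
  using permutes_in_image[OF assms, of i] by simp

lemma count_entries_permute_entries:
  assumes \<sigma>: "\<sigma> permutes {..<dim_row M}" and \<tau>: "\<tau> permutes {..<dim_col M}"
  shows "count_entries c (permute_entries \<sigma> \<tau> M) = count_entries c M"
proof -
  let ?pos = "\<lambda>M. {(i, j). i < dim_row M \<and> j < dim_col M \<and> M $$ (i, j) = c}"
  have inj: "inj (map_prod \<sigma> \<tau>)"
    using permutes_inj[OF \<sigma>] permutes_inj[OF \<tau>] by (rule prod.inj_map)
  have "map_prod \<sigma> \<tau> ` ?pos (permute_entries \<sigma> \<tau> M) = ?pos M"
  proof (intro equalityI subsetI)
    fix p assume "p \<in> map_prod \<sigma> \<tau> ` ?pos (permute_entries \<sigma> \<tau> M)"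
    then show "p \<in> ?pos M"
      by (auto simp: permute_entries_def permutes_lessThan_less_iff[OF \<sigma>]
          permutes_lessThan_less_iff[OF \<tau>])
  next
    fix p assume p: "p \<in> ?pos M"
    obtain i j where ij: "p = (\<sigma> i, \<tau> j)"
      using permutes_surj[OF \<sigma>] permutes_surj[OF \<tau>] by (cases p) (metis surjD)
    then have "(i, j) \<in> ?pos (permute_entries \<sigma> \<tau> M)"
      using p by (auto simp: permute_entries_def permutes_lessThan_less_iff[OF \<sigma>]
          permutes_lessThan_less_iff[OF \<tau>])
    then show "p \<in> map_prod \<sigma> \<tau> ` ?pos (permute_entries \<sigma> \<tau> M)"
      by (rule rev_image_eqI) (simp add: ij)
  qed
  moreover have "card (map_prod \<sigma> \<tau> ` ?pos (permute_entries \<sigma> \<tau> M))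
      = card (?pos (permute_entries \<sigma> \<tau> M))"
    by (rule card_image[OF inj_on_subset[OF inj subset_UNIV]])
  ultimately show ?thesis
    by (simp only: count_entries_def)
qed

lemma mult_permute_columns:
  assumes "dim_col A = dim_row B" and \<tau>: "\<tau> permutes {..<dim_col B}"
  shows "A * permute_entries id \<tau> B = permute_entries id \<tau> (A * B)"
  using assms(1)
  by (intro eq_matI)
    (auto simp: permute_entries_def scalar_prod_def permutes_lessThan_less_iff[OF \<tau>])

text \<open>The identity \<open>(A P\<^sup>-\<^sup>1) (P B) = A B\<close>, which is a reindexing of the inner summation.\<close>

lemma permute_columns_mult_permute_rows:
  fixes A B :: "'a::comm_semiring_0 mat"
  assumes "dim_col A = dim_row B" and \<pi>: "\<pi> permutes {..<dim_row B}"
  shows "permute_entries id \<pi> A * permute_entries \<pi> id B = A * B"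
proof (intro eq_matI)
  fix i j assume "i < dim_row (A * B)" and "j < dim_col (A * B)"
  then have ij: "i < dim_row A" "j < dim_col B" by auto
  have "(permute_entries id \<pi> A * permute_entries \<pi> id B) $$ (i, j)
      = (\<Sum>k<dim_row B. A $$ (i, \<pi> k) * B $$ (\<pi> k, j))"
    using assms(1) ij by (simp add: permute_entries_def scalar_prod_def atLeast0LessThan)
  also have "\<dots> = (\<Sum>k<dim_row B. A $$ (i, k) * B $$ (k, j))"
    by (rule sum.permute[OF \<pi>, unfolded comp_def, symmetric])
  also have "\<dots> = (A * B) $$ (i, j)"
    using assms(1) ij
    by (simp add: scalar_prod_def atLeast0LessThan permutes_lessThan_less_iff[OF \<pi>])
  finally show "(permute_entries id \<pi> A * permute_entries \<pi> id B) $$ (i, j) = (A * B) $$ (i, j)" .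
qed simp_all

lemma mat_inverse_unique:
  fixes A :: "'a::field mat"
  assumes A: "A \<in> carrier_mat n n" and S: "S \<in> carrier_mat n n" and "S * A = 1\<^sub>m n"
  shows "mat_inverse A = Some S"
proof (cases "mat_inverse A")
  case None
  have "A * S = 1\<^sub>m n"
    using mat_mult_left_right_inverse[OF S A assms(3)] .
  then have "A \<in> Units (ring_mat TYPE('a) n ())"
    using A S assms(3) by (auto simp: Units_def ring_mat_simps)
  with mat_inverse(1)[OF A None, of "()"] show ?thesis by simp
next
  case (Some S')
  note S' = mat_inverse(2)[OF A Some]
  have "S' = (S * A) * S'" using S' by (simp add: assms(3) left_mult_one_mat[of S' n n])
  also have "\<dots> = S * (A * S')" using S' by (intro assoc_mult_mat[OF S A]) auto
  also have "\<dots> = S" using S' by (simp add: right_mult_one_mat[OF S])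
  finally show ?thesis using Some by simp
qed

lemma mat_inverse_SomeE:
  assumes "mat_inverse A = Some S"
  obtains n where "A \<in> carrier_mat n n" and "S \<in> carrier_mat n n" and "S * A = 1\<^sub>m n"
proof -
  have "dim_row A = dim_col A"
    using assms by (auto simp: mat_inverse_def split: if_splits)
  then have A: "A \<in> carrier_mat (dim_row A) (dim_row A)" by auto
  show thesis using that[OF A] mat_inverse(2)[OF A assms] by blast
qed

lemma mat_inverse_permute_rows_Some:
  assumes "mat_inverse A = Some S" and \<pi>: "\<pi> permutes {..<dim_row A}"
  shows "mat_inverse (permute_entries \<pi> id A) = Some (permute_entries id \<pi> S)"
proof -
  obtain n where A: "A \<in> carrier_mat n n" and S: "S \<in> carrier_mat n n" and SA: "S * A = 1\<^sub>m n"
    using mat_inverse_SomeE[OF assms(1)] .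
  show ?thesis
  proof (rule mat_inverse_unique)
    show "permute_entries \<pi> id A \<in> carrier_mat n n" "permute_entries id \<pi> S \<in> carrier_mat n n"
      using A S by (auto simp: permute_entries_def)
    show "permute_entries id \<pi> S * permute_entries \<pi> id A = 1\<^sub>m n"
      using permute_columns_mult_permute_rows[of S A \<pi>] A S SA \<pi> by simp
  qed
qed

text \<open>
  This is \<open>(P A)\<^sup>-\<^sup>1 = A\<^sup>-\<^sup>1 P\<^sup>-\<^sup>1\<close>, together with the equivalence of the invertibility of \<open>A\<close> and
  that of \<open>P A\<close>: a permutation of the rows is undone by the inverse permutation, so an
  inverse of \<open>P A\<close> yields one of \<open>A\<close>.
\<close>

lemma mat_inverse_permute_rows:
  assumes \<pi>: "\<pi> permutes {..<dim_row A}"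
  shows "mat_inverse (permute_entries \<pi> id A) = map_option (permute_entries id \<pi>) (mat_inverse A)"
proof (cases "mat_inverse A")
  case (Some S)
  then show ?thesis using mat_inverse_permute_rows_Some[OF Some \<pi>] by simp
next
  case None
  have inv: "inv_into UNIV \<pi> permutes {..<dim_row A}"
    using \<pi> by (rule permutes_inv)
  have undo: "permute_entries (inv_into UNIV \<pi>) id (permute_entries \<pi> id A) = A"
    by (intro eq_matI)
      (auto simp: permute_entries_def permutes_lessThan_less_iff[OF inv] permutes_inverses[OF \<pi>])
  have "mat_inverse (permute_entries \<pi> id A) \<noteq> Some S" for S
    using mat_inverse_permute_rows_Some[of "permute_entries \<pi> id A" S "inv_into UNIV \<pi>"] inv undo None
    by auto
  then show ?thesis using None by (cases "mat_inverse (permute_entries \<pi> id A)") auto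
qed

lemma T2D_mat_permute_list:
  assumes \<pi>: "\<pi> permutes {..<length Ps}"
  shows "T2D_mat K (permute_list \<pi> Ps) B = permute_entries \<pi> id (T2D_mat K Ps B)"
  by (intro eq_matI)
    (auto simp: T2D_mat_def permute_entries_def Ev_def permute_list_nth[OF \<pi>]
      permutes_lessThan_less_iff[OF \<pi>])

lemma TD_mat_permute_list:
  assumes \<pi>: "\<pi> permutes {..<length Ps}" and "n \<le> length B"
  shows "TD_mat K n (permute_list \<pi> Ps) B = permute_entries \<pi> id (TD_mat K n Ps B)"
  using assms(2)
  by (intro eq_matI)
    (auto simp: TD_mat_def T2D_mat_def permute_entries_def Ev_def permute_list_nth[OF \<pi>]
      permutes_lessThan_less_iff[OF \<pi>])

lemma count_entries_CT_mat_permute_list: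
  assumes \<pi>: "\<pi> permutes {..<length Ps}"
  shows "count_entries c (CT_mat K n Q (permute_list \<pi> Ps) B) = count_entries c (CT_mat K n Q Ps B)"
proof -
  have dims: "dim_row (T2D_mat K Ps B) = length Ps" "dim_col (T2D_mat K Ps B) = length B"
    by (simp_all add: T2D_mat_def)
  have inverse: "mat_inverse (T2D_mat K (permute_list \<pi> Ps) B)
      = map_option (permute_entries id \<pi>) (mat_inverse (T2D_mat K Ps B))"
    using mat_inverse_permute_rows[of \<pi> "T2D_mat K Ps B"] \<pi>
    by (simp add: dims T2D_mat_permute_list)
  show ?thesis
  proof (cases "mat_inverse (T2D_mat K Ps B)")
    case None
    \<comment> \<open>Invertibility survives the reordering, and so does its failure: both sides then count
      the entries of the same matrix, \<open>C_mat K n Q B * the None\<close>.\<close>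
    then show ?thesis by (simp add: CT_mat_def inverse)
  next
    case (Some S)
    then obtain m where "T2D_mat K Ps B \<in> carrier_mat m m" and S: "S \<in> carrier_mat m m"
      by (rule mat_inverse_SomeE)
    then have m: "length Ps = m" "length B = m"
      using dims by auto
    have "CT_mat K n Q (permute_list \<pi> Ps) B = permute_entries id \<pi> (CT_mat K n Q Ps B)"
      using mult_permute_columns[of "C_mat K n Q B" S \<pi>] S m \<pi>
      by (simp add: CT_mat_def inverse Some C_mat_def)
    then show ?thesis
      using count_entries_permute_entries[OF permutes_id, of \<pi> "CT_mat K n Q Ps B"] S m \<pi>
      by (simp add: CT_mat_def Some)
  qed
qed

theorem proposition3p5:
  fixes K :: "'f::field set" and n :: nat and D :: "'f set \<Rightarrow>\<^sub>0 int"
    and Q :: "'f set" and Ps :: "'f set list" and B :: "'f list" and \<pi> :: "nat \<Rightarrow> nat"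
  assumes "finite K"
    and "algebraic_function_field K"
    and "chudnovsky_algorithm K n D Q Ps"
    and "effective D"
    and "non_special K (D - frag_of Q)"
    and "divisor_degree K (D - frag_of Q) = genus K - 1"
    and "length Ps = divisor_dim K (frag_cmul 2 D)"
    and "adapted_basis K n D B"
    and "\<pi> permutes {..<length Ps}"
  shows "mu_s K n Q (permute_list \<pi> Ps) B = mu_s K n Q Ps B
    \<and> mu_s0 K n Q (permute_list \<pi> Ps) B = mu_s0 K n Q Ps B
    \<and> N_z (TD_mat K n (permute_list \<pi> Ps) B) = N_z (TD_mat K n Ps B)
    \<and> N_1 (TD_mat K n (permute_list \<pi> Ps) B) = N_1 (TD_mat K n Ps B)
    \<and> N_z (CT_mat K n Q (permute_list \<pi> Ps) B) = N_z (CT_mat K n Q Ps B)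
    \<and> N_1 (CT_mat K n Q (permute_list \<pi> Ps) B) = N_1 (CT_mat K n Q Ps B)"
proof -
  have T: "count_entries c (TD_mat K n (permute_list \<pi> Ps) B) = count_entries c (TD_mat K n Ps B)"
    for c
  proof -
    have "n \<le> length B"
      using assms(8) by (simp add: adapted_basis_def)
    moreover have "\<pi> permutes {..<dim_row (TD_mat K n Ps B)}"
      using assms(9) by (simp add: TD_mat_def)
    ultimately show ?thesis
      using assms(9) by (simp add: TD_mat_permute_list count_entries_permute_entries)
  qed
  note CT = count_entries_CT_mat_permute_list[OF assms(9)]
  show ?thesis
    by (simp add: mu_s_def mu_s0_def T CT)
qed

end
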